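(* For every integer $k>6$ and all $\lambda,\gamma,\tau\in\mathbb R$, there is no (nonzero) $\mathfrak{vect}(1)$-invariant ternary differential operator of order $k$, $A:\mathcal F_\lambda\otimes\mathcal F_\gamma\otimes\mathcal F_\tau\to\mathcal F_{\lambda+\gamma+\tau+k}$.
   Context: For $\lambda\in\mathbb R$, $\mathcal F_\lambda=\{f(dx)^\lambda : f\in\mathbb R[x]\}$ is the space of weighted densities of weight $\lambda$ on $\mathbb R$. The Lie algebra $\mathfrak{vect}(1)$ of polynomial vector fields $X=h\frac{d}{dx}$, $h\in\mathbb R[x]$, acts on $\mathcal F_\lambda$ by $L_X(f(dx)^\lambda)=(hf'+\lambda h'f)(dx)^\lambda$. A ternary differential operator $A:\mathcal F_\lambda\otimes\mathcal F_\gamma\otimes\mathcal F_\tau\to\mathcal F_\mu$ is $\mathfrak{vect}(1)$-invariant if $L_X A(a,b,c)=A(L_Xa,b,c)+A(a,L_Xb,c)+A(a,b,L_Xc)$ for all $X\in\mathfrak{vect}(1)$. An invariant operator of order $k$ has the form $\varphi(dx)^\lambda\otimes\psi(dx)^\gamma\otimes\chi(dx)^\tau\mapsto\sum_{i+j+l=k}\alpha_{i,j,l}\varphi^{(i)}\psi^{(j)}\chi^{(l)}(dx)^\mu$ with constants $\alpha_{i,j,l}\in\mathbb R$ and $\mu=\lambda+\gamma+\tau+k$. *)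

theory Defs
  imports "HOL-Computational_Algebra.Polynomial"
begin

(* A density f (dx)^lambda is represented by its coefficient f; the weight enters only
   through the action of the vector field h d/dx. *)
definition lie_density :: "real \<Rightarrow> real poly \<Rightarrow> real poly \<Rightarrow> real poly" where
  "lie_density lam h f = h * pderiv f + smult lam (pderiv h * f)"

lemma finite_triples_sum_le: "finite {(i, j, l). i + j + l \<le> (k::nat)}"
  by (rule finite_subset[of _ "{..k} \<times> {..k} \<times> {..k}"]) auto

(* Coefficients are arbitrary polynomials; the form with constant coefficients and
   i + j + l = k is a consequence of invariance, not part of the definition. "Order k" bounds the
   order, so operators whose terms of top order vanish, including 0, are allowed. *)
definition ternary_diff_op ::
    "nat \<Rightarrow> (real poly \<Rightarrow> real poly \<Rightarrow> real poly \<Rightarrow> real poly) \<Rightarrow> bool" where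
  "ternary_diff_op k A \<longleftrightarrow>
     (\<exists>\<alpha> :: nat \<Rightarrow> nat \<Rightarrow> nat \<Rightarrow> real poly. \<forall>\<phi> \<psi> \<chi>.
        A \<phi> \<psi> \<chi> =
          (\<Sum>(i, j, l) | i + j + l \<le> k.
             \<alpha> i j l * (pderiv ^^ i) \<phi> * (pderiv ^^ j) \<psi> * (pderiv ^^ l) \<chi>))"

definition vect_invariant ::
    "real \<Rightarrow> real \<Rightarrow> real \<Rightarrow> real \<Rightarrow>
     (real poly \<Rightarrow> real poly \<Rightarrow> real poly \<Rightarrow> real poly) \<Rightarrow> bool" where
  "vect_invariant lam gam tau mu A \<longleftrightarrow>
     (\<forall>h a b c.
        lie_density mu h (A a b c) =
          A (lie_density lam h a) b c +
          A a (lie_density gam h b) c +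
          A a b (lie_density tau h c))"

end

theory Submission
  imports Defs
begin

text \<open>Let the vector field x^(q+1) d/dx be called e_q; on densities of weight w it acts by
e_q x^n = (n + (q+1) w) x^(n+q).  An operator A that is invariant under all polynomial vector
fields commutes with translations, so it is determined by the numbers
beta(a, b, c) = A(x^a, x^b, x^c)(0).  Invariance under x d/dx makes beta vanish unless
a + b + c = k, and invariance under e_q with q \<ge> 1 says that beta, read as a linear functional on
the tensor product of the three density modules, kills the image of every e_q
(invariant_array).  It remains to see that such a beta is zero when k \<ge> 7.

Fix the third slot and let D be the least value of a + b with beta(a, b, k-a-b) nonzero.  The
entries with a + b = D are the coefficients of an invariant operator on the first two slots, and
such operators have order at most three (binary_vanish), so only a few shapes of leading
coefficients have to be examined.

Each shape is treated by the same device.  Suppose that a combination of words in the e_q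
annihilates a vector v of the first two tensor factors.  Since beta kills every image, each letter of
a word can be moved, with a sign, to the third factor, where it multiplies a power of x by a scalar.
The combination therefore becomes a polynomial in the weights and k, times beta(v), and this product
is zero (word_eval).  Every such combination is an identity valid for all arrays; those used below
have degree at most seven, which is where k \<ge> 7 enters.  The combinations themselves were
found by solving linear equations for their coefficients.

Most shapes are excluded outright.  Three survive, at the price of constraints on the weights: the
product of the arguments (product_relation), the bracket of two densities of equal weight
(bracket_relation), and a derivative of one argument of weight zero (derivative_relation).  Write
nu = 1 - mu for the weight dual to the target.  Apart from two exceptional values, the first two
force the weight of the chosen slot to be nu.  Looking from all three slots, and assuming that no
weight is zero, one finds that the four weights coincide (slot_weight_is_dual_weight), and then the
second equation in the relation fails.  If some weight is zero, the entries with index 0 in that slot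
form a binary invariant of order k and vanish; two of the three slots then have a derivative as leading
coefficient, and the two resulting relations contradict each other (zero_weight_contradiction).\<close>

section \<open>Binary operators of order at least four\<close>

text \<open>The same device as for three slots, one slot lower: a nonzero value at one end pins down both
weights.  The two relations come from the words e_1 e_3, e_2 e_2, e_4 and e_1 e_2, e_3, whose
suitable combinations annihilate the vector 1 in the module of weight l.\<close>

lemma binary_end:
  fixes l g :: real and h :: "nat \<Rightarrow> real"
  assumes D: "4 \<le> D"
    and eq: "\<And>q a b. 1 \<le> q \<Longrightarrow> a + b + q = D \<Longrightarrow>
      (real a + real (q + 1) * l) * h (a + q) + (real b + real (q + 1) * g) * h a = 0"
    and nz: "h 0 \<noteq> 0"
  shows "h D \<noteq> 0" "6 * g = 4 - real D" "3 * (1 + l) * (real D - 1) = - real D * (2 * real D - 5)"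
proof -
  define d where "d = real D"
  have d: "4 \<le> d" using D unfolding d_def by simp
  obtain n where n: "D = n + 4" using D le_Suc_ex by (metis add.commute)
  have dn: "d = real n + 4" unfolding d_def n by simp
  have sums: "2 + 1 = (3 :: nat)" "3 + 1 = (4 :: nat)" "2 + 2 = (4 :: nat)" "0 + 2 = (2 :: nat)" by simp_all
  note e = eq[unfolded n]
  have e12: "(2 + 2 * l) * h 3 + (d - 3 + 2 * g) * h 2 = 0"
    using e[of 1 2 "n + 1", unfolded sums] by (simp add: dn)
  have e13: "(3 + 2 * l) * h 4 + (d - 4 + 2 * g) * h 3 = 0"
    using e[of 1 3 n, unfolded sums] by (simp add: dn)
  have e20: "3 * l * h 2 + (d - 2 + 3 * g) * h 0 = 0"
    using e[of 2 0 "n + 2", unfolded sums] by (simp add: dn)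
  have e22: "(2 + 3 * l) * h 4 + (d - 4 + 3 * g) * h 2 = 0"
    using e[of 2 2 n, unfolded sums] by (simp add: dn)
  have e30: "4 * l * h 3 + (d - 3 + 4 * g) * h 0 = 0"
    using e[of 3 0 "n + 1"] by (simp add: dn)
  have e40: "5 * l * h 4 + (d - 4 + 5 * g) * h 0 = 0"
    using e[of 4 0 n] by (simp add: dn)
  have "h 0 * ((d + 1) * (d + 6 * g - 4)) = 0"
    using e13 e22 e30 e20 e40 by algebra
  then have g: "6 * g = 4 - d" using nz d by simp
  have "h 0 * (2 * (d - 3 + 2 * g) * (d - 2 + 3 * g) + 3 * (1 + l) * (d - 3 + 4 * g)) = 0"
    using e12 e20 e30 by algebra
  then have "2 * (d - 3 + 2 * g) * (d - 2 + 3 * g) + 3 * (1 + l) * (d - 3 + 4 * g) = 0"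
    using nz by simp
  then have l: "3 * (1 + l) * (d - 1) = - d * (2 * d - 5)" using g by algebra
  show "6 * g = 4 - real D" using g unfolding d_def .
  show "3 * (1 + l) * (real D - 1) = - real D * (2 * real D - 5)" using l unfolding d_def .
  show "h D \<noteq> 0"
  proof
    assume "h D = 0"
    then have "g = 0" using eq[of D 0 0] D nz by simp
    then have "d = 4" using g by simp
    then have D4: "D = 4" and "l = - (7 / 3)" using l unfolding d_def by simp_all
    have "(1 + 3 * l) * h 3 + h 1 = 0" "(2 + 2 * l) * h 3 + h 2 = 0" "(1 + 2 * l) * h 2 + 2 * h 1 = 0"
      using eq[of 2 1 1] eq[of 1 2 1] eq[of 1 1 2] D4 \<open>g = 0\<close>
      by (simp_all add: numeral_2_eq_2 numeral_3_eq_3)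
    then have "h 3 = 0" unfolding \<open>l = - (7 / 3)\<close> by (simp add: field_simps)
    then show False using e30 nz \<open>d = 4\<close> \<open>g = 0\<close> by simp
  qed
qed

text \<open>If both ends are nonzero, the two evaluations of the weights (this array and its mirror image)
contradict each other.  If both ends vanish, the equations through an end remove everything unless both
weights are zero, and that case is a short recursion.\<close>

lemma binary_vanish:
  fixes l g :: real and h :: "nat \<Rightarrow> real"
  assumes D: "4 \<le> D"
    and eq: "\<And>q a b. 1 \<le> q \<Longrightarrow> a + b + q = D \<Longrightarrow>
      (real a + real (q + 1) * l) * h (a + q) + (real b + real (q + 1) * g) * h a = 0"
    and i: "i \<le> D"
  shows "h i = 0"
proof -
  define h' where "h' = (\<lambda>i. h (D - i))"
  have eq': "(real a + real (q + 1) * g) * h' (a + q) + (real b + real (q + 1) * l) * h' a = 0"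
    if "1 \<le> q" "a + b + q = D" for q a b
  proof -
    have "D - (a + q) = b" "D - a = b + q" using that by auto
    then show ?thesis using eq[of q b a] that unfolding h'_def by (simp add: algebra_simps)
  qed
  have False if "h 0 \<noteq> 0" "h D \<noteq> 0"
  proof -
    have nz': "h' 0 \<noteq> 0" using that unfolding h'_def by simp
    define d where "d = real D"
    have d: "4 \<le> d" using D unfolding d_def by simp
    have "3 * (1 + l) * (d - 1) = - d * (2 * d - 5)" "6 * l = 4 - d"
      using binary_end(3)[OF D eq that(1)] binary_end(2)[OF D eq' nz'] unfolding d_def by auto
    then have "(3 * d - 5) * (d + 2) = 0" by algebra
    then show False using d by auto
  qed
  moreover have "h D \<noteq> 0" if "h 0 \<noteq> 0" using binary_end(1)[OF D eq that] .
  moreover have "h 0 \<noteq> 0" if "h D \<noteq> 0"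
    using binary_end(1)[OF D eq'] that unfolding h'_def by simp
  ultimately have ends: "h 0 = 0" "h D = 0" by auto
  consider "l \<noteq> 0" | "g \<noteq> 0" | "l = 0" "g = 0" by auto
  then show ?thesis
  proof cases
    case 1
    then show ?thesis using eq[of i 0 "D - i"] i ends by (cases "i = 0") auto
  next
    case 2
    then show ?thesis using eq[of "D - i" i 0] i ends by (cases "i = D") auto
  next
    case 3
    have rest: "h (1 + q) = - real b * h 1" if "1 \<le> q" "1 + b + q = D" for q b
      using eq[of q 1 b] that 3 by simp
    have "2 * h 3 + real (D - 3) * h 2 = 0"
      using eq[of 1 2 "D - 3"] D 3 by (simp add: numeral_3_eq_3 numeral_2_eq_2)
    moreover have "h 2 = - real (D - 2) * h 1" "h 3 = - real (D - 3) * h 1"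
      using rest[of 1 "D - 2"] rest[of 2 "D - 3"] D by (simp_all add: numeral_3_eq_3 numeral_2_eq_2)
    ultimately have "(real D - 3) * real D * h 1 = 0"
      using D by (simp add: of_nat_diff del: mult_eq_0_iff) algebra
    then have h1: "h 1 = 0" using D by auto
    show ?thesis
    proof (cases "i \<le> 1")
      case True
      then show ?thesis using h1 ends by (cases i) auto
    next
      case False
      then show ?thesis using rest[of "i - 1" "D - i"] i h1 by auto
    qed
  qed
qed

section \<open>Words of vector fields acting on two slots\<close>

definition act :: "real \<Rightarrow> real \<Rightarrow> nat \<Rightarrow> (nat \<Rightarrow> nat \<Rightarrow> real) \<Rightarrow> nat \<Rightarrow> nat \<Rightarrow> real" where
  "act l g q f a b =
     (real a + real (q + 1) * l) * f (a + q) b + (real b + real (q + 1) * g) * f a (b + q)"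

definition word :: "real \<Rightarrow> real \<Rightarrow> nat list \<Rightarrow> (nat \<Rightarrow> nat \<Rightarrow> real) \<Rightarrow> nat \<Rightarrow> nat \<Rightarrow> real" where
  "word l g ps f = fold (act l g) ps f"

lemmas word_expand = word_def act_def numeral_eq_Suc

fun scal :: "real \<Rightarrow> real \<Rightarrow> nat list \<Rightarrow> nat \<Rightarrow> real" where
  "scal \<kappa> s [] m = 1"
| "scal \<kappa> s (p # ps) m = - (\<kappa> - real (m + sum_list ps) + real (p + 1) * s) * scal \<kappa> s ps m"

text \<open>Multiplying an array by a function of the order a + b commutes with words up to a shift, because every
letter of a word raises the order by a fixed amount.\<close>

lemma word_radial:
  assumes "\<And>a b. a + b \<le> M \<Longrightarrow> h a b = c (a + b) * f a b" and "a + b + sum_list ps \<le> M"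
  shows "word l g ps h a b = c (a + b + sum_list ps) * word l g ps f a b"
  using assms
proof (induction ps arbitrary: M h f c)
  case Nil
  then show ?case by (simp add: word_def)
next
  case (Cons p ps)
  have "act l g p h x y = c (x + y + p) * act l g p f x y" if "x + y \<le> M - p" for x y
  proof -
    have "x + p + y \<le> M" "x + (y + p) \<le> M" using that Cons.prems(2) by auto
    then show ?thesis
      using Cons.prems(1)[of "x + p" y] Cons.prems(1)[of x "y + p"]
      by (simp add: act_def algebra_simps)
  qed
  then have "word l g ps (act l g p h) a b
      = c (a + b + sum_list ps + p) * word l g ps (act l g p f) a b"
    using Cons.prems(2) by (intro Cons.IH[where M = "M - p" and c = "\<lambda>n. c (n + p)"]) auto
  then show ?case by (simp add: word_def add.assoc add.commute add.left_commute)
qed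

text \<open>The situation seen from one slot of weight tau = s + 1: the array f a b = beta(a, b, k-a-b) with
kappa = k + 1.  The scalar is the action of e_q on the power x^c of the third slot, since
c + (q+1) tau = kappa - (a+b) + (q+1) s when a + b + c + q = k.  Only orders up to seven are
recorded.\<close>

locale corner =
  fixes l g \<kappa> s :: real and f :: "nat \<Rightarrow> nat \<Rightarrow> real"
  assumes act_eq: "1 \<le> q \<Longrightarrow> a + b + q \<le> 7 \<Longrightarrow>
      act l g q f a b = - (\<kappa> - real (a + b) + real (q + 1) * s) * f a b"
    and kappa: "8 \<le> \<kappa>"
begin

text \<open>The letters of a word are moved to the third slot one by one, beginning with the outermost; this
is why the scalars are evaluated at decreasing orders.\<close>

lemma word_eval:
  assumes "a + b + sum_list ps \<le> 7" and "list_all (\<lambda>p. 1 \<le> p) ps"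
  shows "word l g ps f a b = scal \<kappa> s ps (a + b) * f a b"
  using assms
proof (induction ps)
  case Nil
  then show ?case by (simp add: word_def)
next
  case (Cons p ps)
  have "word l g (p # ps) f a b = word l g ps (act l g p f) a b"
    by (simp add: word_def)
  also have "\<dots> = - (\<kappa> - real (a + b + sum_list ps) + real (p + 1) * s) * word l g ps f a b"
    using Cons.prems
    by (intro word_radial[where M = "7 - p" and c = "\<lambda>n. - (\<kappa> - real n + real (p + 1) * s)"] act_eq) auto
  finally show ?case using Cons by simp
qed

end

section \<open>Combinations of words that annihilate a leading vector\<close>

text \<open>Each lemma is an identity between arrays and needs no equation for f.  The final number is the degree of the
common target of the words.  For a given shape, words are applied at its leading indices and also
at indices of lower order, where f vanishes in the applications.\<close>

lemma annihilator_product_6: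
  "(-180 * l - 180 * g - 600) * word l g [6] f 0 0
     + 36 * word l g [1, 5] f 0 0
     + (144 * l + 144 * g + 288) * word l g [2, 4] f 0 0
     + (-135 * l - 135 * g - 90) * word l g [3, 3] f 0 0
     - 108 * word l g [1, 4, 1] f 0 0
     - 80 * word l g [2, 2, 2] f 0 0
     + 180 * word l g [2, 3, 1] f 0 0 = 0"
  by (simp add: word_expand; simp add: field_simps power2_eq_square power3_eq_cube)

lemma annihilator_product_7:
  "(120 * l + 120 * g - 390) * word l g [7] f 0 0
     + (-72 * l - 72 * g - 12) * word l g [3, 4] f 0 0
     + (80 * l + 80 * g) * word l g [5, 2] f 0 0
     - 180 * word l g [6, 1] f 0 0
     + 48 * word l g [2, 1, 4] f 0 0
     - 40 * word l g [2, 3, 2] f 0 0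
     + 45 * word l g [3, 3, 1] f 0 0
     - 60 * word l g [5, 1, 1] f 0 0 = 0"
  by (simp add: word_expand; simp add: field_simps power2_eq_square power3_eq_cube)

lemma annihilator_bracket_3:
  "(-12 * l^2 + 8 * l * g^2 + 12 * l * g) * word l g [2] f 1 0
     + (6 * l^2 - 6 * l * g) * word l g [1, 1] f 1 0
     + 8 * l^2 * g * word l g [2] f 0 1
     + (-6 * l^2 * g - 2 * l^2 - 6 * l * g^2 - 10 * l * g - 2 * l - 2 * g^2 - 2 * g) * word l g [3] f 0 0
     + (8 * l * g + 10 * l + 4 * g + 4) * word l g [2, 1] f 0 0
     + (-3 * l - 2) * word l g [1, 1, 1] f 0 0 = 0"
  by (simp add: word_expand; simp add: field_simps power2_eq_square power3_eq_cube)

lemma annihilator_bracket_5a: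
  "(180 * l^2 + 360 * l * g) * word l g [4] f 1 0
     - 270 * l * g * word l g [1, 3] f 1 0
     + 240 * l * g * word l g [2, 2] f 1 0
     + 240 * l * g * word l g [2, 2] f 0 1
     - 270 * l * g * word l g [3, 1] f 0 1
     + (348 * l * g + 102 * l + 102 * g + 28) * word l g [5] f 0 0
     + (-180 * l * g - 60 * l - 60 * g - 20) * word l g [2, 3] f 0 0
     + (216 * l * g - 36 * l + 54 * g + 66) * word l g [4, 1] f 0 0
     - 45 * word l g [1, 3, 1] f 0 0
     + 50 * word l g [2, 2, 1] f 0 0 = 0"
  by (simp add: word_expand; simp add: field_simps power2_eq_square power3_eq_cube)

lemma annihilator_bracket_5b:
  "(-72 * l^2 + 36 * l * g^2 + 180 * l * g) * word l g [4] f 1 0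
     + 180 * l * g * word l g [3, 1] f 1 0
     + (36 * l^2 * g + 108 * l * g) * word l g [4] f 0 1
     + (-180 * l * g + 180 * g^2) * word l g [2, 2] f 0 1
     + 180 * l * g * word l g [3, 1] f 0 1
     + (-30 * l^2 * g - 6 * l^2 - 30 * l * g^2 + 102 * l * g - 96 * l - 6 * g^2 + 12 * g - 28) * word l g [5] f 0 0
     + (-144 * l * g - 36 * g) * word l g [1, 4] f 0 0
     + (150 * l * g + 54 * l + 54 * g + 20) * word l g [2, 3] f 0 0
     + 24 * word l g [4, 1] f 0 0
     + (-90 * g - 38) * word l g [2, 2, 1] f 0 0
     + 27 * word l g [3, 1, 1] f 0 0 = 0"
  by (simp add: word_expand; simp add: field_simps power2_eq_square power3_eq_cube)

lemma annihilator_equal_bracket_4: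
  "(-4 * l^2 - 2 * l) * word l l [3] f 1 0
     + (4 * l + 3) * word l l [2, 1] f 1 0
     - word l l [1, 1, 1] f 1 0
     + (4 * l + 3) * word l l [3] f 0 1
     - word l l [1, 2] f 0 1
     + (-2 * l - 1) * word l l [4] f 0 0 = 0"
  by (simp add: word_expand; simp add: field_simps power2_eq_square power3_eq_cube)

lemma annihilator_equal_bracket_6:
  "(-66 * l - 9) * word l l [5] f 1 0
     - 15 * word l l [3, 2] f 1 0
     + 27 * word l l [4, 1] f 1 0
     + (24 * l^2 - 54 * l) * word l l [5] f 0 1
     + 2 * word l l [1, 4] f 0 1
     + (12 * l - 9) * word l l [2, 3] f 0 1
     + (-36 * l - 29) * word l l [4, 1] f 0 1
     + 18 * word l l [1, 3, 1] f 0 1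
     - 12 * word l l [2, 2, 1] f 0 1
     + 24 * l * word l l [6] f 0 0
     + 3 * word l l [3, 3] f 0 0
     + 6 * word l l [4, 2] f 0 0 = 0"
  by (simp add: word_expand; simp add: field_simps power2_eq_square power3_eq_cube)

lemma annihilator_equal_bracket_7:
  "(-192 * l^2 - 264 * l - 284) * word l l [6] f 1 0
     + (78 * l + 357) * word l l [3, 3] f 1 0
     + (-128 * l - 520) * word l l [4, 2] f 1 0
     + (224 * l + 376) * word l l [5, 1] f 1 0
     - 36 * word l l [1, 4, 1] f 1 0
     + 48 * word l l [2, 2, 2] f 1 0
     - 52 * word l l [3, 1, 2] f 1 0
     + 604 * word l l [6] f 0 1
     - 384 * word l l [2, 4] f 0 1
     + 275 * word l l [3, 3] f 0 1
     + 108 * word l l [5, 1] f 0 1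
     + 389 * word l l [7] f 0 0
     - 68 * word l l [1, 6] f 0 0
     - 122 * word l l [4, 3] f 0 0
     + 192 * word l l [5, 2] f 0 0 = 0"
  by (simp add: word_expand; simp add: field_simps power2_eq_square power3_eq_cube)

lemma annihilator_derivative_7a:
  "(108 * g - 636) * word 0 g [6] f 1 0
     + (-135 * g - 405) * word 0 g [3, 3] f 1 0
     + 144 * g * word 0 g [4, 2] f 1 0
     + 216 * word 0 g [1, 2, 3] f 1 0
     - 108 * word 0 g [1, 4, 1] f 1 0
     - 80 * word 0 g [2, 2, 2] f 1 0
     - 36 * word 0 g [3, 1, 2] f 1 0 = 0"
  by (simp add: word_expand; simp add: field_simps power2_eq_square power3_eq_cube)

lemma annihilator_derivative_7b:
  "(-192 * g - 312) * word 0 g [6] f 1 0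
     + 108 * g * word 0 g [1, 5] f 1 0
     + (-144 * g + 276) * word 0 g [2, 4] f 1 0
     + (108 * g - 324) * word 0 g [3, 3] f 1 0
     - 36 * g * word 0 g [1, 3, 2] f 1 0
     + (32 * g - 16) * word 0 g [2, 2, 2] f 1 0
     + 150 * word 0 g [3, 1, 2] f 1 0
     - 144 * word 0 g [4, 1, 1] f 1 0
     + 27 * word 0 g [1, 3, 1, 1] f 1 0
     - 24 * word 0 g [2, 1, 1, 2] f 1 0 = 0"
  by (simp add: word_expand; simp add: field_simps power2_eq_square power3_eq_cube)

lemma annihilator_derivative_zero_3:
  "- 2 * word 0 0 [2] f 1 0
     + word 0 0 [1, 1] f 1 0 = 0"
  by (simp add: word_expand; simp add: field_simps power2_eq_square power3_eq_cube)

lemma annihilator_derivative_zero_4: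
  "- 2 * word 0 0 [3] f 1 0
     + word 0 0 [2, 1] f 1 0 = 0"
  by (simp add: word_expand; simp add: field_simps power2_eq_square power3_eq_cube)

lemma annihilator_second_order_4:
  "- 12 * l * word l (-1 - l) [2] f 2 0
     + 12 * l * word l (-1 - l) [2] f 0 2
     + 6 * word l (-1 - l) [1, 1] f 0 2
     + 20 * l * word l (-1 - l) [1, 2] f 1 0
     + (40 * l^2 + 40 * l) * word l (-1 - l) [3] f 0 1
     + 6 * word l (-1 - l) [1, 2] f 0 1
     - 5 * word l (-1 - l) [1, 1, 1] f 0 1
     + (-24 * l^2 - 32 * l) * word l (-1 - l) [4] f 0 0
     - 3 * word l (-1 - l) [1, 3] f 0 0 = 0"
  by (simp add: word_expand; simp add: field_simps power2_eq_square power3_eq_cube)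

lemma annihilator_second_order_5:
  "- 36 * word l (-1 - l) [3] f 0 2
     + 18 * word l (-1 - l) [2, 1] f 0 2
     - 96 * l * word l (-1 - l) [4] f 1 0
     + 90 * l * word l (-1 - l) [2, 2] f 1 0
     + 30 * word l (-1 - l) [4] f 0 1
     + (70 * l + 62) * word l (-1 - l) [2, 2] f 0 1
     + 39 * word l (-1 - l) [3, 1] f 0 1
     - 15 * word l (-1 - l) [1, 2, 1] f 0 1
     + (124 * l + 68) * word l (-1 - l) [5] f 0 0
     + (-105 * l - 57) * word l (-1 - l) [2, 3] f 0 0
     + (45 * l + 51) * word l (-1 - l) [4, 1] f 0 0 = 0"
  by (simp add: word_expand; simp add: field_simps power2_eq_square power3_eq_cube)

lemma annihilator_derivative_bracket_4:
  "(4 * g^2 + 6 * g - 10) * word 0 g [2] f 2 0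
     + (-3 * g - 2) * word 0 g [1, 1] f 2 0
     - 10 * g * word 0 g [1, 1] f 1 1
     + (-8 * g^2 - 30 * g - 22) * word 0 g [3] f 1 0
     + (12 * g + 18) * word 0 g [1, 2] f 1 0 = 0"
  by (simp add: word_expand; simp add: field_simps power2_eq_square power3_eq_cube)

lemma annihilator_derivative_bracket_5:
  "(9 * g - 21) * word 0 g [3] f 2 0
     + 6 * word 0 g [1, 2] f 2 0
     + (-168 * g - 216) * word 0 g [3] f 1 1
     + (48 * g + 108) * word 0 g [1, 2] f 1 1
     - 18 * word 0 g [1, 1, 1] f 1 1
     + (30 * g + 36) * word 0 g [4] f 1 0
     + (-16 * g - 14) * word 0 g [2, 2] f 1 0 = 0"
  by (simp add: word_expand; simp add: field_simps power2_eq_square power3_eq_cube)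

lemma annihilator_derivative_bracket_7:
  "108 * word 0 g [1, 4] f 2 0
     - 108 * word 0 g [3, 2] f 2 0
     + (432 * g - 216) * word 0 g [5] f 1 1
     + 648 * word 0 g [3, 2] f 1 1
     - 648 * word 0 g [4, 1] f 1 1
     + 216 * word 0 g [1, 3, 1] f 1 1
     - 216 * word 0 g [2, 1, 2] f 1 1
     + (108 * g + 348) * word 0 g [6] f 1 0
     + (-27 * g + 243) * word 0 g [3, 3] f 1 0
     - 504 * word 0 g [4, 2] f 1 0
     - 108 * word 0 g [2, 1, 3] f 1 0
     + 128 * word 0 g [2, 2, 2] f 1 0 = 0"
  by (simp add: word_expand; simp add: field_simps power2_eq_square power3_eq_cube)

lemma annihilator_derivative_product_5:
  "- 12 * word 0 0 [3] f 1 1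
     + 6 * word 0 0 [1, 2] f 1 1
     - word 0 0 [1, 1, 1] f 1 1 = 0"
  by (simp add: word_expand; simp add: field_simps power2_eq_square power3_eq_cube)

lemma annihilator_derivative_product_6:
  "- 6 * word 0 0 [4] f 1 1
     + 2 * word 0 0 [2, 2] f 1 1
     + 6 * word 0 0 [3, 1] f 1 1
     - word 0 0 [1, 1, 2] f 1 1 = 0"
  by (simp add: word_expand; simp add: field_simps power2_eq_square power3_eq_cube)

lemma annihilator_third_order_5:
  "28 * word (-2/3) (-2/3) [2] f 2 1
     + 40 * word (-2/3) (-2/3) [2] f 0 3
     - 9 * word (-2/3) (-2/3) [1, 1] f 0 3
     - 42 * word (-2/3) (-2/3) [3] f 2 0
     + 12 * word (-2/3) (-2/3) [4] f 1 0 = 0"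
  by (simp add: word_expand; simp add: field_simps power2_eq_square power3_eq_cube)

lemma annihilator_third_order_6:
  "192 * word (-2/3) (-2/3) [2, 1] f 2 1
     + 288 * word (-2/3) (-2/3) [3] f 0 3
     + 32 * word (-2/3) (-2/3) [5] f 0 1
     - 12 * word (-2/3) (-2/3) [6] f 0 0
     + 63 * word (-2/3) (-2/3) [3, 3] f 0 0 = 0"
  by (simp add: word_expand; simp add: field_simps power2_eq_square power3_eq_cube)

lemma annihilator_third_order_7:
  "- 135 * word (-2/3) (-2/3) [1, 3] f 3 0
     + 234 * word (-2/3) (-2/3) [4] f 2 1
     + 270 * word (-2/3) (-2/3) [2, 2] f 2 1
     + 1132 * word (-2/3) (-2/3) [5] f 1 1
     - 360 * word (-2/3) (-2/3) [2, 3] f 1 1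
     + 54 * word (-2/3) (-2/3) [6] f 1 0
     + 612 * word (-2/3) (-2/3) [5, 1] f 1 0 = 0"
  by (simp add: word_expand; simp add: field_simps power2_eq_square power3_eq_cube)

lemma annihilator_derivative_second_order_5:
  "- 4 * word 0 (-2) [2] f 1 2
     + 2 * word 0 (-2) [1, 1] f 1 2
     - word 0 (-2) [3] f 2 0
     + 2 * word 0 (-2) [4] f 1 0 = 0"
  by (simp add: word_expand; simp add: field_simps power2_eq_square power3_eq_cube)

lemma annihilator_derivative_second_order_6:
  "- 24 * word 0 (-2) [3] f 1 2
     + 8 * word 0 (-2) [1, 2] f 1 2
     - 4 * word 0 (-2) [4] f 2 0
     - word 0 (-2) [1, 3] f 2 0
     - 8 * word 0 (-2) [4] f 1 1
     + 18 * word 0 (-2) [5] f 1 0 = 0"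
  by (simp add: word_expand; simp add: field_simps power2_eq_square power3_eq_cube)

lemma annihilator_two_derivatives_bracket_6:
  "- 20 * word 0 0 [3] f 2 1
     - word 0 0 [1, 1, 1] f 2 1
     - 8 * word 0 0 [1, 2] f 1 2
     - 20 * word 0 0 [4] f 1 1
     + 7 * word 0 0 [1, 1, 2] f 1 1 = 0"
  by (simp add: word_expand; simp add: field_simps power2_eq_square power3_eq_cube)

lemma annihilator_two_derivatives_bracket_7:
  "6 * word 0 0 [2, 2] f 2 1
     - word 0 0 [1, 2, 1] f 2 1
     + 30 * word 0 0 [4] f 1 2
     - 12 * word 0 0 [3, 1] f 1 2
     + word 0 0 [1, 2, 1] f 1 2
     - 18 * word 0 0 [5] f 1 1 = 0"
  by (simp add: word_expand; simp add: field_simps power2_eq_square power3_eq_cube)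

section \<open>Constraints on the weights from each leading coefficient\<close>

text \<open>The first equation says that the weight of the third slot is the weight 1 - mu dual to the target.
The quadratic equations in the following definitions are what remains of the relations from words
of higher degree.\<close>

definition product_relation :: "real \<Rightarrow> real \<Rightarrow> real \<Rightarrow> real \<Rightarrow> bool" where
  "product_relation \<kappa> l g s \<longleftrightarrow>
     l + g + 2 * s + \<kappa> = 0 \<and> (\<kappa> + 1) * (\<kappa> + 2) + 18 * s * (\<kappa> + 1) + 72 * s^2 = 0"

definition bracket_relation :: "real \<Rightarrow> real \<Rightarrow> real \<Rightarrow> bool" where
  "bracket_relation \<kappa> l s \<longleftrightarrow>
     2 * l + \<kappa> + 2 * s = 0 \<and> \<kappa>^2 + 18 * \<kappa> * s + 56 * s^2 + \<kappa> - 18 * s - 2 = 0 \<or>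
     s = 0 \<and> 2 * l = 1 - \<kappa> \<or> s = - 1"

definition derivative_relation :: "real \<Rightarrow> real \<Rightarrow> real \<Rightarrow> bool" where
  "derivative_relation \<kappa> g s \<longleftrightarrow>
     9 * g * (\<kappa> + 8 * s) + 8 * \<kappa>^2 - \<kappa> + 72 * \<kappa> * s + 72 * s^2 = 0 \<and>
     g * (4 * \<kappa> - 5 + 27 * s) + 3 * \<kappa>^2 - 7 * \<kappa> - 1 + 22 * \<kappa> * s - 29 * s + 12 * s^2 = 0"

text \<open>Both relations depend on the weights of the two arguments only through their sum, as they would for
a single argument of weight l + g.  Their difference is a product of two linear factors.\<close>

lemma (in corner) product_lead:
  assumes "f 0 0 \<noteq> 0"
  shows "product_relation \<kappa> l g s"
proof -
  have "\<kappa> * (9 * (l + g) * (\<kappa> + 8 * s + 1) + 8 * \<kappa>^2 + 72 * \<kappa> * s + 6 * \<kappa> + 72 * s^2 - 2) * f 0 0 = 0"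
    using annihilator_product_6[of l g f] by (simp add: word_eval) algebra
  then have 6: "9 * (l + g) * (\<kappa> + 8 * s + 1) + 8 * \<kappa>^2 + 72 * \<kappa> * s + 6 * \<kappa> + 72 * s^2 - 2 = 0"
    using assms kappa by simp
  have "\<kappa> * (8 * (l + g) * (\<kappa> + 9 * s + 1) + 7 * \<kappa>^2 + 70 * \<kappa> * s + 5 * \<kappa> + 72 * s^2 - 2 * s - 2) * f 0 0 = 0"
    using annihilator_product_7[of l g f] by (simp add: word_eval) algebra
  then have 7: "8 * (l + g) * (\<kappa> + 9 * s + 1) + 7 * \<kappa>^2 + 70 * \<kappa> * s + 5 * \<kappa> + 72 * s^2 - 2 * s - 2 = 0"
    using assms kappa by simp
  have "(\<kappa> + 1) * (l + g + 2 * s + \<kappa>) = 0" using 6 7 by algebra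
  then have 1: "l + g + 2 * s + \<kappa> = 0" using kappa by simp
  moreover have "(\<kappa> + 1) * (\<kappa> + 2) + 18 * s * (\<kappa> + 1) + 72 * s^2 = 0" using 6 1 by algebra
  ultimately show ?thesis unfolding product_relation_def by simp
qed
text \<open>Leading coefficient: the first order bracket of two densities of distinct nonzero weights.\<close>

lemma (in corner) bracket_lead:
  assumes "l \<noteq> 0" "g \<noteq> 0" "l \<noteq> g" "t \<noteq> 0"
    and lead: "f 0 0 = 0" "f 1 0 = g * t" "f 0 1 = - l * t"
  shows False
proof -
  have "l * g * (l - g) * t * (4 * (l + g) * (\<kappa> + 3 * s - 1) + 3 * \<kappa> * (\<kappa> - 1) + 12 * \<kappa> * s + 12 * s^2) = 0"
    using annihilator_bracket_3[of l g f] by (simp add: word_eval lead[simplified] del: mult_eq_0_iff) algebra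
  then have r3: "4 * (l + g) * (\<kappa> + 3 * s - 1) + 3 * \<kappa> * (\<kappa> - 1) + 12 * \<kappa> * s + 12 * s^2 = 0"
    using assms(1-4) by simp
  have "l * g * (l - g) * t * ((\<kappa> - 1) * (\<kappa> + 6 * s)) = 0"
    using annihilator_bracket_5a[of l g f] by (simp add: word_eval lead[simplified] del: mult_eq_0_iff) algebra
  then have \<kappa>: "\<kappa> = - 6 * s" using assms(1-4) kappa by simp
  have "l * g * (l - g) * t * ((l + g) * (\<kappa> + 5 * s - 1) + 5 * s * (s + 1)) = 0"
    using annihilator_bracket_5b[of l g f] by (simp add: word_eval lead[simplified] del: mult_eq_0_iff) algebra
  then have "(l + g) * (\<kappa> + 5 * s - 1) + 5 * s * (s + 1) = 0"
    using assms(1-4) by simp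
  then have "(s + 1) * (5 * s - (l + g)) = 0" using \<kappa> by algebra
  then have "l + g = 5 * s" using \<kappa> kappa by auto
  then have "s * (6 * s + 1) = 0" using r3 \<kappa> by algebra
  then show False using \<kappa> kappa by auto
qed

text \<open>For equal weights the leading bracket is antisymmetric, and the relations used for distinct weights
carry a factor l - g and become void.  The difference of the relations in degrees 4 and 6 splits into
linear factors; on the factor that expresses duality of the weights, degree 7 gives one more equation.\<close>

lemma (in corner) equal_bracket_lead:
  assumes "g = l" "t \<noteq> 0" and lead: "f 0 0 = 0" "f 1 0 = t" "f 0 1 = - t"
  shows "bracket_relation \<kappa> l s"
proof -
  note ev = word_eval[unfolded \<open>g = l\<close>]
  have "t * (4 * l^2 * (\<kappa> + 4 * s - 1) + l * (4 * \<kappa>^2 + 20 * \<kappa> * s - 6 * \<kappa> + 24 * s^2 - 4 * s + 2)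
      + \<kappa>^3 + 6 * \<kappa>^2 * s - 2 * \<kappa>^2 + 12 * \<kappa> * s^2 - 4 * \<kappa> * s + \<kappa> + 8 * s^3 + 2 * s) = 0"
    using annihilator_equal_bracket_4[of l f] by (simp add: ev lead[simplified] del: mult_eq_0_iff) algebra
  then have r4: "4 * l^2 * (\<kappa> + 4 * s - 1) + l * (4 * \<kappa>^2 + 20 * \<kappa> * s - 6 * \<kappa> + 24 * s^2 - 4 * s + 2)
      + \<kappa>^3 + 6 * \<kappa>^2 * s - 2 * \<kappa>^2 + 12 * \<kappa> * s^2 - 4 * \<kappa> * s + \<kappa> + 8 * s^3 + 2 * s = 0"
    using \<open>t \<noteq> 0\<close> by simp
  have "t * (4 * l^2 * (\<kappa> + 6 * s - 1) + l * (4 * \<kappa>^2 + 28 * \<kappa> * s - 6 * \<kappa> + 36 * s^2 - 4 * s + 2)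
      + \<kappa>^3 + 8 * \<kappa>^2 * s - 2 * \<kappa>^2 + 18 * \<kappa> * s^2 - 4 * \<kappa> * s + \<kappa> + 12 * s^3 + 2 * s) = 0"
    using annihilator_equal_bracket_6[of l f] by (simp add: ev lead[simplified] del: mult_eq_0_iff) algebra
  then have r6: "4 * l^2 * (\<kappa> + 6 * s - 1) + l * (4 * \<kappa>^2 + 28 * \<kappa> * s - 6 * \<kappa> + 36 * s^2 - 4 * s + 2)
      + \<kappa>^3 + 8 * \<kappa>^2 * s - 2 * \<kappa>^2 + 18 * \<kappa> * s^2 - 4 * \<kappa> * s + \<kappa> + 12 * s^3 + 2 * s = 0"
    using \<open>t \<noteq> 0\<close> by simp
  show ?thesis
  proof (cases "2 * l + \<kappa> + 2 * s = 0")
    case True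
    then have \<kappa>: "\<kappa> = - 2 * l - 2 * s" by simp
    have "t * (\<kappa> * (\<kappa>^2 + 18 * \<kappa> * s + 56 * s^2 + \<kappa> - 18 * s - 2)) = 0"
      using annihilator_equal_bracket_7[of l f] \<kappa> by (simp add: ev lead[simplified] del: mult_eq_0_iff) algebra
    then show ?thesis using True \<open>t \<noteq> 0\<close> kappa unfolding bracket_relation_def by simp
  next
    case False
    have "s * (2 * l + \<kappa> + s) * (2 * l + \<kappa> + 2 * s) = 0" using r4 r6 by algebra
    then consider "s = 0" | "s = - 2 * l - \<kappa>" using False by auto
    then show ?thesis
    proof cases
      case 1
      then have "(\<kappa> - 1) * (2 * l + \<kappa> - 1) * (2 * l + \<kappa> + 2 * s) = 0" using r4 by algebra
      then show ?thesis using 1 False kappa unfolding bracket_relation_def by auto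
    next
      case 2
      then have "s * (s + 1) * (\<kappa> - 1) = 0" using r4 by algebra
      then show ?thesis using 2 False kappa unfolding bracket_relation_def by auto
    qed
  qed
qed

text \<open>Leading coefficient: the derivative of the first argument, invariant because its weight is zero.\<close>

lemma (in corner) derivative_lead:
  assumes "l = 0" "f 1 0 \<noteq> 0"
  shows "derivative_relation \<kappa> g s"
proof -
  note ev = word_eval[unfolded \<open>l = 0\<close>]
  have "f 1 0 * (\<kappa> - 1) * (9 * g * (\<kappa> + 8 * s) + 8 * \<kappa>^2 - \<kappa> + 72 * \<kappa> * s + 72 * s^2) = 0"
    using annihilator_derivative_7a[of g f] by (simp add: ev del: mult_eq_0_iff) algebra
  then have 1: "9 * g * (\<kappa> + 8 * s) + 8 * \<kappa>^2 - \<kappa> + 72 * \<kappa> * s + 72 * s^2 = 0"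
    using assms kappa by simp
  have "f 1 0 * (\<kappa> - 1) * (g * (4 * \<kappa> * (\<kappa> + 1) + 36 * s * (\<kappa> + 2) + 72 * s^2)
      + 3 * \<kappa>^3 + \<kappa>^2 - 2 * \<kappa> + s * (30 * \<kappa>^2 + 42 * \<kappa>) + s^2 * (84 * \<kappa> + 72) + 72 * s^3) = 0"
    using annihilator_derivative_7b[of g f] by (simp add: ev del: mult_eq_0_iff) algebra
  then have "g * (4 * \<kappa> * (\<kappa> + 1) + 36 * s * (\<kappa> + 2) + 72 * s^2)
      + 3 * \<kappa>^3 + \<kappa>^2 - 2 * \<kappa> + s * (30 * \<kappa>^2 + 42 * \<kappa>) + s^2 * (84 * \<kappa> + 72) + 72 * s^3 = 0"
    using assms kappa by simp
  then have "\<kappa> * (g * (4 * \<kappa> - 5 + 27 * s) + 3 * \<kappa>^2 - 7 * \<kappa> - 1 + 22 * \<kappa> * s - 29 * s + 12 * s^2) = 0"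
    using 1 by algebra
  then have "g * (4 * \<kappa> - 5 + 27 * s) + 3 * \<kappa>^2 - 7 * \<kappa> - 1 + 22 * \<kappa> * s - 29 * s + 12 * s^2 = 0"
    using kappa by simp
  then show ?thesis using 1 unfolding derivative_relation_def by simp
qed

lemma (in corner) derivative_lead_zero_weights:
  assumes "l = 0" "g = 0"
  shows "f 1 0 = 0"
proof (rule ccontr)
  assume nz: "f 1 0 \<noteq> 0"
  note ev = word_eval[unfolded assms]
  have "f 1 0 * (\<kappa>^2 + 4 * \<kappa> * s - \<kappa> + 4 * s^2) = 0"
    using annihilator_derivative_zero_3[of f] by (simp add: ev del: mult_eq_0_iff) algebra
  then have r3: "\<kappa>^2 + 4 * \<kappa> * s - \<kappa> + 4 * s^2 = 0" using nz by simp
  have "f 1 0 * (\<kappa>^2 + 5 * \<kappa> * s - \<kappa> + 6 * s^2 + s) = 0"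
    using annihilator_derivative_zero_4[of f] by (simp add: ev del: mult_eq_0_iff) algebra
  then have "\<kappa>^2 + 5 * \<kappa> * s - \<kappa> + 6 * s^2 + s = 0" using nz by simp
  then have "s * (\<kappa> + 2 * s + 1) = 0" using r3 by algebra
  then consider "s = 0" | "\<kappa> = - 2 * s - 1" by auto
  then show False
  proof cases
    case 1
    then have "\<kappa> * (\<kappa> - 1) = 0" using r3 by algebra
    then show False using kappa by auto
  next
    case 2
    then have "\<kappa> - 1 = 0" using r3 by algebra
    then show False using kappa by auto
  qed
qed

text \<open>Leading coefficient: the second order invariant operator that exists when the weights add up to -1.\<close>

lemma (in corner) second_order_lead:
  assumes "g = - 1 - l" "l \<noteq> 0"
    and lead: "f 0 0 = 0" "f 1 0 = 0" "f 0 1 = 0"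
      "f 2 0 = (2 + 2 * l) * t" "f 1 1 = (1 + 2 * l) * t" "f 0 2 = 2 * l * t"
  shows "t = 0"
proof (rule ccontr)
  assume nz: "t \<noteq> 0"
  note ev = word_eval[unfolded \<open>g = - 1 - l\<close>]
  have "l * t * (\<kappa>^2 + 4 * \<kappa> * s - 3 * \<kappa> + 4 * s^2 - 4 * s + 2) = 0"
    using annihilator_second_order_4[of l f] by (simp add: ev lead[simplified] del: mult_eq_0_iff) algebra
  then have r4: "\<kappa>^2 + 4 * \<kappa> * s - 3 * \<kappa> + 4 * s^2 - 4 * s + 2 = 0" using nz \<open>l \<noteq> 0\<close> by simp
  have "l * t * (\<kappa>^2 + 5 * \<kappa> * s - 3 * \<kappa> + 6 * s^2 - 4 * s + 2) = 0"
    using annihilator_second_order_5[of l f] by (simp add: ev lead[simplified] del: mult_eq_0_iff) algebra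
  then have "\<kappa>^2 + 5 * \<kappa> * s - 3 * \<kappa> + 6 * s^2 - 4 * s + 2 = 0" using nz \<open>l \<noteq> 0\<close> by simp
  then have "s * (\<kappa> + 2 * s) = 0" using r4 by algebra
  then consider "s = 0" | "\<kappa> = - 2 * s" by auto
  then show False
  proof cases
    case 1
    then have "(\<kappa> - 1) * (\<kappa> - 2) = 0" using r4 by algebra
    then show False using kappa by auto
  next
    case 2
    then have "\<kappa> - 2 = 0" using r4 by algebra
    then show False using kappa by auto
  qed
qed

text \<open>Leading coefficient: the bracket of the derivative of the first argument, which has weight 1, with the
second argument.  In terms of v = kappa + 2 s the relations factor.\<close>

lemma (in corner) derivative_bracket_lead:
  assumes "l = 0" "g \<noteq> 0" and lead: "f 1 0 = 0" "f 2 0 = - 2 * g * t" "f 1 1 = t"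
  shows "t = 0"
proof (rule ccontr)
  assume nz: "t \<noteq> 0"
  note ev = word_eval[unfolded \<open>l = 0\<close>]
  define v where "v = \<kappa> + 2 * s"
  have "g * t * (4 * g^2 * (\<kappa> + 3 * s - 2) + g * (3 * v^2 - 9 * \<kappa> - 12 * s + 6) - 3 * v^2 + 5 * \<kappa> + 2) = 0"
    using annihilator_derivative_bracket_4[of g f] unfolding v_def by (simp add: ev lead[simplified] del: mult_eq_0_iff) algebra
  then have r4: "4 * g^2 * (\<kappa> + 3 * s - 2) + g * (3 * v^2 - 9 * \<kappa> - 12 * s + 6) - 3 * v^2 + 5 * \<kappa> + 2 = 0"
    using nz \<open>g \<noteq> 0\<close> by simp
  have "t * ((g + v) * (g * (\<kappa> + 4 * s - 2) + v^2 - 3 * \<kappa> + 2)) = 0"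
    using annihilator_derivative_bracket_5[of g f] unfolding v_def by (simp add: ev lead[simplified] del: mult_eq_0_iff) algebra
  then have r5: "(g + v) * (g * (\<kappa> + 4 * s - 2) + v^2 - 3 * \<kappa> + 2) = 0" using nz by simp
  have "t * (s * (s + 1) * (2 * g + v + 2)) = 0"
    using annihilator_derivative_bracket_7[of g f] unfolding v_def by (simp add: ev lead[simplified] del: mult_eq_0_iff) algebra
  then consider "s = 0" | "s = - 1" | "v = - 2 * g - 2" using nz by auto
  then show False
  proof cases
    case 1
    then have "(\<kappa> - 2) * ((g + \<kappa>) * (g + \<kappa> - 1)) = 0" using r5 unfolding v_def by algebra
    then consider "g = - \<kappa>" | "g = 1 - \<kappa>" using kappa by auto
    then show False
    proof cases
      assume "g = - \<kappa>"
      then have "(\<kappa> - 2) * (\<kappa> - 1) * (\<kappa> + 1) = 0" using r4 1 unfolding v_def by algebra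
      then show False using kappa by auto
    next
      assume "g = 1 - \<kappa>"
      then have "(\<kappa> - 2) * \<kappa> * (\<kappa> - 5) = 0" using r4 1 unfolding v_def by algebra
      then show False using kappa by auto
    qed
  next
    case 2
    then have "(\<kappa> - 6) * ((g + \<kappa> - 2) * (g + \<kappa> - 1)) = 0" using r5 unfolding v_def by algebra
    then consider "g = 2 - \<kappa>" | "g = 1 - \<kappa>" using kappa by auto
    then show False
    proof cases
      assume "g = 2 - \<kappa>"
      then have "(\<kappa> - 1) * (\<kappa> - 5) * (\<kappa> - 6) = 0" using r4 2 unfolding v_def by algebra
      then show False using kappa by auto
    next
      assume "g = 1 - \<kappa>"
      then have "(\<kappa> - 2) * (\<kappa> - 5) * \<kappa> = 0" using r4 2 unfolding v_def by algebra
      then show False using kappa by auto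
    qed
  next
    case 3
    then have "(g + 2) * (g + 3) * (\<kappa> - 2) = 0" using r5 unfolding v_def by algebra
    then consider "g = - 2" | "g = - 3" using kappa by auto
    then show False
    proof cases
      assume g: "g = - 2"
      have "\<kappa> - 2 = 0" using r4 3 g unfolding v_def by algebra
      then show False using kappa by auto
    next
      assume g: "g = - 3"
      have "\<kappa> - 2 = 0" using r4 3 g unfolding v_def by algebra
      then show False using kappa by auto
    qed
  qed
qed

text \<open>Leading coefficient: the product of the derivatives of two densities of weight zero.\<close>

lemma (in corner) derivative_product_lead:
  assumes "l = 0" "g = 0"
  shows "f 1 1 = 0"
proof (rule ccontr)
  assume nz: "f 1 1 \<noteq> 0"
  note ev = word_eval[unfolded assms]
  define v where "v = \<kappa> + 2 * s"
  have "f 1 1 * (v * (v^2 - 3 * \<kappa> + 2)) = 0"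
    using annihilator_derivative_product_5[of f] unfolding v_def by (simp add: ev del: mult_eq_0_iff) algebra
  then have r5: "v * (v^2 - 3 * \<kappa> + 2) = 0" using nz by simp
  have "f 1 1 * (v^2 * (\<kappa> + 3 * s) - 3 * \<kappa>^2 - 5 * \<kappa> * s + 4 * s^2 + 2 * \<kappa> + 6 * s) = 0"
    using annihilator_derivative_product_6[of f] unfolding v_def by (simp add: ev del: mult_eq_0_iff) algebra
  then have r6: "v^2 * (\<kappa> + 3 * s) - 3 * \<kappa>^2 - 5 * \<kappa> * s + 4 * s^2 + 2 * \<kappa> + 6 * s = 0"
    using nz by simp
  consider "v = 0" | "v^2 - 3 * \<kappa> + 2 = 0" using r5 by auto
  then show False
  proof cases
    case 1
    then have "\<kappa> * (\<kappa> - 2) = 0" using r6 unfolding v_def by algebra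
    then show False using kappa by auto
  next
    case 2
    then have "(\<kappa> - 1) * (\<kappa> - 2) = 0" using r6 unfolding v_def by algebra
    then show False using kappa by auto
  qed
qed

text \<open>Leading coefficient: the Grozman operator, the third order invariant operator on two densities of
weight -2/3 that is not a composition of operators of lower order.\<close>

lemma (in corner) third_order_lead:
  assumes "l = - (2 / 3)" "g = - (2 / 3)"
    and lead: "f 0 0 = 0" "f 1 0 = 0" "f 0 1 = 0" "f 2 0 = 0" "f 1 1 = 0" "f 0 2 = 0"
      "f 3 0 = 2 * t" "f 2 1 = t" "f 1 2 = - t" "f 0 3 = - 2 * t"
  shows "t = 0"
proof (rule ccontr)
  assume nz: "t \<noteq> 0"
  note ev = word_eval[unfolded assms(1,2)]
  have "t * (9 * \<kappa>^2 + 36 * \<kappa> * s - 37 * \<kappa> + 36 * s^2 - 48 * s + 30) = 0"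
    using annihilator_third_order_5[of f] by (simp add: ev lead[simplified] del: mult_eq_0_iff) algebra
  then have r5: "9 * \<kappa>^2 + 36 * \<kappa> * s - 37 * \<kappa> + 36 * s^2 - 48 * s + 30 = 0" using nz by simp
  have "t * (\<kappa>^2 + 5 * \<kappa> * s - 4 * \<kappa> + 6 * s^2 - 5 * s + 3) = 0"
    using annihilator_third_order_6[of f] by (simp add: ev lead[simplified] del: mult_eq_0_iff) algebra
  then have r6: "\<kappa>^2 + 5 * \<kappa> * s - 4 * \<kappa> + 6 * s^2 - 5 * s + 3 = 0" using nz by simp
  have "t * (2 * \<kappa> + 15 * s^2 + 25 * s - 6) = 0"
    using annihilator_third_order_7[of f] by (simp add: ev lead[simplified] del: mult_eq_0_iff) algebra
  then have r7: "2 * \<kappa> + 15 * s^2 + 25 * s - 6 = 0" using nz by simp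
  have "s * (45 * s - 7) * (3 * s + 5) = 0" using r5 r6 r7 by algebra
  then consider "s = 0" | "s = 7 / 45" | "s = - 5 / 3" by fastforce
  then show False using r7 kappa by cases (auto simp: power2_eq_square)
qed

text \<open>Leading coefficient: the second order operator for the weights 1 and -2, applied to the derivative
of the first argument.\<close>

lemma (in corner) derivative_second_order_lead:
  assumes "l = 0" "g = - 2"
    and lead: "f 1 0 = 0" "f 2 0 = 0" "f 1 1 = 0" "f 3 0 = 6 * t" "f 2 1 = 3 * t" "f 1 2 = t"
  shows "t = 0"
proof (rule ccontr)
  assume nz: "t \<noteq> 0"
  note ev = word_eval[unfolded assms(1,2)]
  have "t * (\<kappa>^2 + 4 * \<kappa> * s - 5 * \<kappa> + 4 * s^2 - 8 * s + 6) = 0"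
    using annihilator_derivative_second_order_5[of f] by (simp add: ev lead[simplified] del: mult_eq_0_iff) algebra
  then have r5: "\<kappa>^2 + 4 * \<kappa> * s - 5 * \<kappa> + 4 * s^2 - 8 * s + 6 = 0" using nz by simp
  have "t * (\<kappa>^2 + 5 * \<kappa> * s - 5 * \<kappa> + 6 * s^2 - 9 * s + 6) = 0"
    using annihilator_derivative_second_order_6[of f] by (simp add: ev lead[simplified] del: mult_eq_0_iff) algebra
  then have "\<kappa>^2 + 5 * \<kappa> * s - 5 * \<kappa> + 6 * s^2 - 9 * s + 6 = 0" using nz by simp
  then have "s * (\<kappa> + 2 * s - 1) = 0" using r5 by algebra
  then consider "s = 0" | "\<kappa> = 1 - 2 * s" by auto
  then show False
  proof cases
    case 1
    then have "(\<kappa> - 2) * (\<kappa> - 3) = 0" using r5 by algebra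
    then show False using kappa by auto
  next
    case 2
    then have "\<kappa> - 3 = 0" using r5 by algebra
    then show False using kappa by auto
  qed
qed

text \<open>Leading coefficient: the bracket of the derivatives of two densities of weight zero.\<close>

lemma (in corner) two_derivatives_bracket_lead:
  assumes "l = 0" "g = 0" and lead: "f 1 1 = 0" "f 2 1 = t" "f 1 2 = - t"
  shows "t = 0"
proof (rule ccontr)
  assume nz: "t \<noteq> 0"
  note ev = word_eval[unfolded assms(1,2)]
  define v where "v = \<kappa> + 2 * s"
  have "t * (v * (v^2 - 4 * \<kappa> + 3)) = 0"
    using annihilator_two_derivatives_bracket_6[of f] unfolding v_def by (simp add: ev lead[simplified] del: mult_eq_0_iff) algebra
  then have r6: "v * (v^2 - 4 * \<kappa> + 3) = 0" using nz by simp
  have "t * (v^2 * (\<kappa> + 3 * s) - 4 * \<kappa>^2 - 7 * \<kappa> * s + 5 * s^2 + 3 * \<kappa> + 9 * s) = 0"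
    using annihilator_two_derivatives_bracket_7[of f] unfolding v_def by (simp add: ev lead[simplified] del: mult_eq_0_iff) algebra
  then have r7: "v^2 * (\<kappa> + 3 * s) - 4 * \<kappa>^2 - 7 * \<kappa> * s + 5 * s^2 + 3 * \<kappa> + 9 * s = 0"
    using nz by simp
  consider "v = 0" | "v^2 - 4 * \<kappa> + 3 = 0" using r6 by auto
  then show False
  proof cases
    case 1
    then have "\<kappa> * (\<kappa> - 2) = 0" using r7 unfolding v_def by algebra
    then show False using kappa by auto
  next
    case 2
    then have "(\<kappa> - 1) * (\<kappa> - 3) = 0" using r7 unfolding v_def by algebra
    then show False using kappa by auto
  qed
qed

section \<open>Leading coefficients of order at most three\<close>

lemma act_flip: "act g l q (\<lambda>a b. f b a) a b = act l g q f b a"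
  by (simp add: act_def)

text \<open>The equations are symmetric in the first two slots, so each shape needs to be treated in one of its two
orientations only.\<close>

lemma (in corner) flip: "corner g l \<kappa> s (\<lambda>a b. f b a)"
proof
  fix q a b :: nat
  assume "1 \<le> q" "a + b + q \<le> 7"
  then show "act g l q (\<lambda>a b. f b a) a b = - (\<kappa> - real (a + b) + real (q + 1) * s) * f b a"
    using act_eq[of q b a] unfolding act_flip[of g l q f a b] by (simp add: add.commute)
qed (rule kappa)

lemma (in corner) order_one_cases:
  assumes "f 0 0 = 0" and nz: "f 1 0 \<noteq> 0 \<or> f 0 1 \<noteq> 0"
  shows "g = l \<and> l \<noteq> 0 \<and> bracket_relation \<kappa> l s \<or> l = 0 \<and> g \<noteq> 0 \<and> derivative_relation \<kappa> g s \<or>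
    g = 0 \<and> l \<noteq> 0 \<and> derivative_relation \<kappa> l s"
proof -
  interpret flipped: corner g l \<kappa> s "\<lambda>a b. f b a" by (rule flip)
  have e: "l * f 1 0 + g * f 0 1 = 0"
    using act_eq[of 1 0 0] assms(1) by (simp add: act_def)
  consider "l = 0" "g = 0" | "l = 0" "g \<noteq> 0" | "g = 0" "l \<noteq> 0" | "l \<noteq> 0" "g \<noteq> 0" by auto
  then show ?thesis
  proof cases
    case 1
    then show ?thesis using derivative_lead_zero_weights[OF 1] flipped.derivative_lead_zero_weights[OF 1(2,1)] nz by simp
  next
    case 2
    then have "f 1 0 \<noteq> 0" using e nz by auto
    then show ?thesis using derivative_lead[OF 2(1)] 2 by simp
  next
    case 3
    then have "f 0 1 \<noteq> 0" using e nz by auto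
    then show ?thesis using flipped.derivative_lead[OF 3(1)] 3 by simp
  next
    case 4
    then have "f 1 0 \<noteq> 0" using e nz by auto
    show ?thesis
    proof (cases "g = l")
      case True
      then have "l * (f 1 0 + f 0 1) = 0" using e unfolding distrib_left by simp
      then have "f 0 1 = - f 1 0" using 4 by simp
      then have "bracket_relation \<kappa> l s"
        using equal_bracket_lead[OF True \<open>f 1 0 \<noteq> 0\<close> assms(1) refl] by simp
      then show ?thesis
        using True 4 by simp
    next
      case False
      define u where "u = f 1 0 / g"
      have f10: "f 1 0 = g * u" using 4 unfolding u_def by simp
      have "g * (f 0 1 + l * u) = 0" using e unfolding f10 by algebra
      then have f01: "f 0 1 = - l * u" using 4 by simp
      have "u \<noteq> 0" using \<open>f 1 0 \<noteq> 0\<close> f10 by auto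
      then show ?thesis
        using bracket_lead[OF 4 _ _ assms(1) f10 f01] False by blast
    qed
  qed
qed

text \<open>Together with the next lemma, this is the classification of binary invariants of order two and three:
below the leading order everything is zero, so the equations lose their right-hand side and determine the
leading coefficients up to a factor.\<close>

lemma (in corner) order_two_vanish:
  assumes low: "f 0 0 = 0" "f 1 0 = 0" "f 0 1 = 0"
  shows "f 2 0 = 0 \<and> f 1 1 = 0 \<and> f 0 2 = 0"
proof -
  interpret flipped: corner g l \<kappa> s "\<lambda>a b. f b a" by (rule flip)
  have e1: "(1 + 2 * l) * f 2 0 + 2 * g * f 1 1 = 0"
    and e2: "2 * l * f 1 1 + (1 + 2 * g) * f 0 2 = 0"
    and e3: "l * f 2 0 + g * f 0 2 = 0"
    using act_eq[of 1 1 0] act_eq[of 1 0 1] act_eq[of 2 0 0] low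
    by (simp_all add: act_def numeral_2_eq_2)
  consider "l = 0" "g = 0" | "l = 0" "g \<noteq> 0" | "g = 0" "l \<noteq> 0" | "l \<noteq> 0" "g \<noteq> 0" by auto
  then show ?thesis
  proof cases
    case 1
    then show ?thesis using derivative_product_lead e1 e2 by simp
  next
    case 2
    then have "f 0 2 = 0" "f 2 0 = - 2 * g * f 1 1" using e1 e3 by auto
    then show ?thesis using derivative_bracket_lead[OF 2 low(2) _ refl] by simp
  next
    case 3
    then have "f 2 0 = 0" "f 0 2 = - 2 * l * f 1 1" using e2 e3 by auto
    then show ?thesis using flipped.derivative_bracket_lead[OF 3 low(3) _ refl] by simp
  next
    case 4
    define u where "u = f 2 0 / g"
    have f20: "f 2 0 = g * u" using 4 unfolding u_def by simp
    have "g * (f 0 2 + l * u) = 0" using e3 unfolding f20 by algebra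
    then have f02: "f 0 2 = - l * u" using 4 by simp
    have "g * ((1 + 2 * l) * u + 2 * f 1 1) = 0" using e1 unfolding f20 by algebra
    then have "(1 + 2 * l) * u + 2 * f 1 1 = 0" using 4 by simp
    then have f11: "f 1 1 = - (1 + 2 * l) * u / 2" by (simp add: field_simps)
    have "l * u * (1 + l + g) = 0" using e2 unfolding f11 f02 by (simp add: field_simps)
    then have "u = 0 \<or> g = - 1 - l" using 4 by auto
    moreover have "u = 0" if "g = - 1 - l"
      using second_order_lead[OF that 4(1) low, of "- u / 2"] f20 f11 f02 that
      by (simp add: field_simps)
    ultimately show ?thesis using f20 f11 f02 by auto
  qed
qed

lemma (in corner) order_three_vanish:
  assumes low: "f 0 0 = 0" "f 1 0 = 0" "f 0 1 = 0" "f 2 0 = 0" "f 1 1 = 0" "f 0 2 = 0"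
  shows "f 3 0 = 0 \<and> f 2 1 = 0 \<and> f 1 2 = 0 \<and> f 0 3 = 0"
proof -
  interpret flipped: corner g l \<kappa> s "\<lambda>a b. f b a" by (rule flip)
  have e1: "(1 + l) * f 3 0 + g * f 2 1 = 0"
    and e2: "(1 + 2 * l) * f 2 1 + (1 + 2 * g) * f 1 2 = 0"
    and e3: "l * f 1 2 + (1 + g) * f 0 3 = 0"
    and e4: "(1 + 3 * l) * f 3 0 + 3 * g * f 1 2 = 0"
    and e5: "3 * l * f 2 1 + (1 + 3 * g) * f 0 3 = 0"
    and e6: "l * f 3 0 + g * f 0 3 = 0"
    using act_eq[of 1 2 0] act_eq[of 1 1 1] act_eq[of 1 0 2] act_eq[of 2 1 0] act_eq[of 2 0 1]
      act_eq[of 3 0 0] low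
    by (simp_all add: act_def numeral_2_eq_2 numeral_3_eq_3 algebra_simps)
  consider "l = 0" "g = 0" | "l = 0" "g \<noteq> 0" | "g = 0" "l \<noteq> 0" | "l \<noteq> 0" "g \<noteq> 0" by auto
  then show ?thesis
  proof cases
    case 1
    then have "f 3 0 = 0" "f 0 3 = 0" "f 1 2 = - f 2 1" using e2 e4 e5 by auto
    then show ?thesis using two_derivatives_bracket_lead[OF 1 low(5) refl] by simp
  next
    case 2
    then have z: "f 0 3 = 0" "f 3 0 = - 3 * g * f 1 2" "f 2 1 = - (1 + 2 * g) * f 1 2"
      using e2 e4 e6 by (auto simp: algebra_simps)
    have "g * (g + 2) * f 1 2 = 0" using e1 z 2 by algebra
    then have "f 1 2 = 0 \<or> g = - 2" using 2 by auto
    moreover have "f 1 2 = 0" if "g = - 2"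
      using derivative_second_order_lead[OF 2(1) that low(2,4,5), of "f 1 2"] z that by simp
    ultimately show ?thesis using z by auto
  next
    case 3
    then have z: "f 3 0 = 0" "f 0 3 = - 3 * l * f 2 1" "f 1 2 = - (1 + 2 * l) * f 2 1"
      using e2 e5 e6 by (auto simp: algebra_simps)
    have "l * (l + 2) * f 2 1 = 0" using e3 z 3 by algebra
    then have "f 2 1 = 0 \<or> l = - 2" using 3 by auto
    moreover have "f 2 1 = 0" if "l = - 2"
      using flipped.derivative_second_order_lead[OF 3(1) that low(3,6,5), of "f 2 1"] z that by simp
    ultimately show ?thesis using z by auto
  next
    case 4
    define u where "u = f 3 0 / g"
    have f30: "f 3 0 = g * u" using 4 unfolding u_def by simp
    have "g * (f 0 3 + l * u) = 0" using e6 unfolding f30 by algebra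
    then have f03: "f 0 3 = - l * u" using 4 by simp
    have "g * ((1 + l) * u + f 2 1) = 0" using e1 unfolding f30 by algebra
    then have "(1 + l) * u + f 2 1 = 0" using 4 by simp
    then have f21: "f 2 1 = - (1 + l) * u" by (simp add: algebra_simps)
    have "l * (f 1 2 - (1 + g) * u) = 0" using e3 unfolding f03 by algebra
    then have f12: "f 1 2 = (1 + g) * u" using 4 by simp
    have "g * (u * (4 + 3 * l + 3 * g)) = 0" using e4 unfolding f30 f12 by algebra
    then have sum: "u * (4 + 3 * l + 3 * g) = 0" using 4 by simp
    have "u * (g - l) = 0" using e2 sum unfolding f21 f12 by algebra
    moreover have "u = 0" if "g = l"
    proof (rule ccontr)
      assume "u \<noteq> 0"
      then have "l = - (2 / 3)" "g = - (2 / 3)" using sum that by auto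
      then show False
        using third_order_lead[OF _ _ low, of "- u / 3"] f30 f21 f12 f03 \<open>u \<noteq> 0\<close> by simp
    qed
    ultimately have "u = 0" by auto
    then show ?thesis using f30 f21 f12 f03 by simp
  qed
qed

section \<open>Three-index arrays and the three slots\<close>

text \<open>The array lists the values at 0 on monomials, so it is the array of coefficients of the operator
multiplied by factorials; in this scaling the equations have no binomial coefficients.\<close>

definition invariant_array ::
    "real \<Rightarrow> real \<Rightarrow> real \<Rightarrow> nat \<Rightarrow> (nat \<Rightarrow> nat \<Rightarrow> nat \<Rightarrow> real) \<Rightarrow> bool" where
  "invariant_array l g t k \<beta> \<longleftrightarrow>
     (\<forall>q a b c. 1 \<le> q \<longrightarrow>
        (real a + real (q + 1) * l) * \<beta> (a + q) b c + (real b + real (q + 1) * g) * \<beta> a (b + q) c +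
        (real c + real (q + 1) * t) * \<beta> a b (c + q) = 0) \<and>
     (\<forall>a b c. a + b + c \<noteq> k \<longrightarrow> \<beta> a b c = 0)"

lemma invariant_arrayD:
  assumes "invariant_array l g t k \<beta>"
  shows "1 \<le> q \<Longrightarrow> (real a + real (q + 1) * l) * \<beta> (a + q) b c +
        (real b + real (q + 1) * g) * \<beta> a (b + q) c + (real c + real (q + 1) * t) * \<beta> a b (c + q) = 0"
    and "a + b + c \<noteq> k \<Longrightarrow> \<beta> a b c = 0"
  using assms unfolding invariant_array_def by blast+

lemma invariant_array_rotate:
  assumes "invariant_array l g t k \<beta>"
  shows "invariant_array g t l k (\<lambda>a b c. \<beta> c a b)"
proof -
  have "(real a + real (q + 1) * g) * \<beta> c (a + q) b + (real b + real (q + 1) * t) * \<beta> c a (b + q) +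
      (real c + real (q + 1) * l) * \<beta> (c + q) a b = 0" if "1 \<le> q" for q a b c
    using invariant_arrayD(1)[OF assms that, of c a b] by simp
  moreover have "\<beta> c a b = 0" if "a + b + c \<noteq> k" for a b c
    using invariant_arrayD(2)[OF assms, of c a b] that by (simp add: add_ac)
  ultimately show ?thesis unfolding invariant_array_def by blast
qed

lemma corner_of_array:
  assumes "invariant_array l g t k \<beta>" "7 \<le> k"
  shows "corner l g (real k + 1) (t - 1) (\<lambda>a b. \<beta> a b (k - a - b))"
proof
  fix q a b :: nat
  assume q: "1 \<le> q" "a + b + q \<le> 7"
  define c where "c = k - q - a - b"
  have c: "k - (a + q) - b = c" "k - a - (b + q) = c" "k - a - b = c + q"
    and rc: "real c = real k - real q - real a - real b"
    using q assms(2) unfolding c_def by auto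
  show "act l g q (\<lambda>a b. \<beta> a b (k - a - b)) a b =
      - (real k + 1 - real (a + b) + real (q + 1) * (t - 1)) * \<beta> a b (k - a - b)"
    using invariant_arrayD(1)[OF assms(1) q(1), of a b c]
    unfolding act_def c rc by (simp add: algebra_simps)
qed (use assms(2) in simp)

text \<open>At the least order with a nonzero entry the entries form a binary invariant array, which
vanishes if that order is four or more.\<close>

lemma low_order_nonzero:
  assumes inv: "invariant_array l g t k \<beta>" and nz: "\<beta> x y z \<noteq> 0"
  shows "\<exists>a b. a + b \<le> 3 \<and> a + b \<le> k \<and> \<beta> a b (k - a - b) \<noteq> 0"
proof (rule ccontr)
  assume none: "\<not> ?thesis"
  have "\<beta> a (d - a) (k - d) = 0" if "a \<le> d" "d \<le> k" for a d
    using that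
  proof (induction d arbitrary: a rule: less_induct)
    case (less d)
    show ?case
    proof (cases "d \<le> 3")
      case True
      have "\<not> (a + (d - a) \<le> 3 \<and> a + (d - a) \<le> k \<and> \<beta> a (d - a) (k - a - (d - a)) \<noteq> 0)"
        using none by blast
      then show ?thesis using True less.prems by simp
    next
      case False
      define h where "h = (\<lambda>a. \<beta> a (d - a) (k - d))"
      have eq: "(real a + real (q + 1) * l) * h (a + q) + (real b + real (q + 1) * g) * h a = 0"
        if "1 \<le> q" "a + b + q = d" for q a b
      proof -
        have "\<beta> a (d - q - a) (k - (d - q)) = 0" using that less.prems by (intro less.IH) auto
        moreover have "d - q - a = b" "k - (d - q) = k - d + q" "d - (a + q) = b" "d - a = b + q"
          using that less.prems by auto
        ultimately show ?thesis
          using invariant_arrayD(1)[OF inv that(1), of a b "k - d"] unfolding h_def by simp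
      qed
      have "h a = 0"
      proof (rule binary_vanish)
        show "4 \<le> d" "a \<le> d" using False less.prems by simp_all
      qed (rule eq)
      then show ?thesis unfolding h_def .
    qed
  qed
  from this[of x "x + y"] have "\<beta> x y z = 0"
    using invariant_arrayD(2)[OF inv, of x y z] by (cases "x + y + z = k") auto
  then show False using nz by simp
qed

text \<open>The first alternative also records that the coefficient of the undifferentiated product is
nonzero; this excludes it for slots in which the array vanishes at index 0.\<close>

lemma weight_cases:
  assumes inv: "invariant_array l g t k \<beta>" and nz: "\<beta> x y z \<noteq> 0" and k: "7 \<le> k"
    and \<kappa>: "\<kappa> = real k + 1" and s: "s = t - 1"
  shows "\<beta> 0 0 k \<noteq> 0 \<and> product_relation \<kappa> l g s \<or> g = l \<and> l \<noteq> 0 \<and> bracket_relation \<kappa> l s \<or>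
    l = 0 \<and> g \<noteq> 0 \<and> derivative_relation \<kappa> g s \<or> g = 0 \<and> l \<noteq> 0 \<and> derivative_relation \<kappa> l s"
proof -
  define f where "f = (\<lambda>a b. \<beta> a b (k - a - b))"
  interpret corner l g \<kappa> s f
    using corner_of_array[OF inv k] unfolding f_def \<kappa> s .
  obtain a b where ab: "a + b \<le> 3" "f a b \<noteq> 0"
    using low_order_nonzero[OF inv nz] unfolding f_def by blast
  have f00: "f 0 0 = \<beta> 0 0 k" unfolding f_def by simp
  show ?thesis
  proof (cases "f 0 0 = 0 \<and> f 1 0 = 0 \<and> f 0 1 = 0")
    case False
    show ?thesis
    proof (cases "f 0 0 = 0")
      case True
      then show ?thesis using order_one_cases[OF True] False by blast
    next
      case False
      then show ?thesis using product_lead[OF False] f00 by simp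
    qed
  next
    case True
    then have two: "f 2 0 = 0 \<and> f 1 1 = 0 \<and> f 0 2 = 0" using order_two_vanish by simp
    then have three: "f 3 0 = 0 \<and> f 2 1 = 0 \<and> f 1 2 = 0 \<and> f 0 3 = 0"
      using True order_three_vanish by simp
    have "a = 0 \<and> b = 0 \<or> a = 1 \<and> b = 0 \<or> a = 0 \<and> b = 1 \<or> a = 2 \<and> b = 0 \<or> a = 1 \<and> b = 1 \<or>
        a = 0 \<and> b = 2 \<or> a = 3 \<and> b = 0 \<or> a = 2 \<and> b = 1 \<or> a = 1 \<and> b = 2 \<or> a = 0 \<and> b = 3"
      using ab(1) by presburger
    then have "f a b = 0" using True two three by auto
    then show ?thesis using ab(2) by simp
  qed
qed

text \<open>Subtracting the two relations from their mirror images leaves g = t or two incompatible values of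
g + t.  For g = t, eliminating g leaves a cubic polynomial in kappa - 8 with positive coefficients.\<close>

lemma zero_weight_contradiction:
  fixes \<kappa> g t :: real
  assumes \<kappa>: "8 \<le> \<kappa>" and "g \<noteq> 0"
    and z: "derivative_relation \<kappa> g (t - 1)" and y: "derivative_relation \<kappa> t (g - 1)"
  shows False
proof -
  have z1: "9 * g * (\<kappa> + 8 * (t - 1)) + 8 * \<kappa>^2 - \<kappa> + 72 * \<kappa> * (t - 1) + 72 * (t - 1)^2 = 0"
    and z2: "g * (4 * \<kappa> - 5 + 27 * (t - 1)) + 3 * \<kappa>^2 - 7 * \<kappa> - 1 + 22 * \<kappa> * (t - 1) - 29 * (t - 1) + 12 * (t - 1)^2 = 0"
    and y1: "9 * t * (\<kappa> + 8 * (g - 1)) + 8 * \<kappa>^2 - \<kappa> + 72 * \<kappa> * (g - 1) + 72 * (g - 1)^2 = 0"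
    and y2: "t * (4 * \<kappa> - 5 + 27 * (g - 1)) + 3 * \<kappa>^2 - 7 * \<kappa> - 1 + 22 * \<kappa> * (g - 1) - 29 * (g - 1) + 12 * (g - 1)^2 = 0"
    using z y unfolding derivative_relation_def by blast+
  show False
  proof (cases "g = t")
    case False
    have "(g - t) * (8 - 7 * \<kappa> - 8 * (g + t)) = 0" using z1 y1 by algebra
    moreover have "(g - t) * (7 - 6 * \<kappa> - 4 * (g + t)) = 0" using z2 y2 by algebra
    ultimately have "8 - 7 * \<kappa> - 8 * (g + t) = 0" "7 - 6 * \<kappa> - 4 * (g + t) = 0" using False by auto
    then show False using \<kappa> by argo
  next
    case True
    have e1: "144 * g^2 + g * (81 * \<kappa> - 216) + 8 * \<kappa>^2 - 73 * \<kappa> + 72 = 0" using z1 True by algebra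
    have e2: "39 * g^2 + g * (26 * \<kappa> - 85) + 3 * \<kappa>^2 - 29 * \<kappa> + 40 = 0" using z2 True by algebra
    have r: "g * (1272 - 195 * \<kappa>) = (\<kappa> - 8) * (40 * \<kappa> - 123)" using e1 e2 by algebra
    define m where "m = \<kappa> - 8"
    have m: "\<kappa> = 8 + m" "0 \<le> m" using \<kappa> unfolding m_def by auto
    \<comment> \<open>the expansion at kappa = 8, where g = 0 is the only common solution\<close>
    have "m * (26325 * m^3 + 583635 * m^2 + 3720678 * m + 5402592) = 0"
      using r e2 m(1) by algebra
    moreover have "26325 * m^3 + 583635 * m^2 + 3720678 * m + 5402592 > 0"
      using m(2) by (intro add_nonneg_pos add_nonneg_nonneg) auto
    ultimately have "m = 0" by auto
    then show False using r m \<open>g \<noteq> 0\<close> by simp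
  qed
qed

text \<open>If the first weight is zero, the entries with first index 0 satisfy the equations of a binary operator of
order k and vanish.  Hence the product cannot lead in the other two slots, and in both of them only
the derivative of the argument of weight zero can.\<close>

lemma first_weight_nonzero:
  assumes inv: "invariant_array l g t k \<beta>" and nz: "\<beta> x y z \<noteq> 0" and k: "7 \<le> k"
  shows "l \<noteq> 0"
proof
  assume "l = 0"
  have vanish: "\<beta> 0 b c = 0" for b c
  proof (cases "b + c = k")
    case True
    define h where "h = (\<lambda>b. \<beta> 0 b (k - b))"
    have eq: "(real a + real (q + 1) * g) * h (a + q) + (real b + real (q + 1) * t) * h a = 0"
      if "1 \<le> q" "a + b + q = k" for q a b
    proof -
      have "k - (a + q) = b" "k - a = b + q" using that by auto
      then show ?thesis
        using invariant_arrayD(1)[OF inv that(1), of 0 a b] \<open>l = 0\<close> unfolding h_def by simp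
    qed
    have "h b = 0"
    proof (rule binary_vanish)
      show "4 \<le> k" "b \<le> k" using k True by simp_all
    qed (rule eq)
    moreover have "k - b = c" using True by simp
    ultimately show ?thesis unfolding h_def by simp
  next
    case False
    then show ?thesis using invariant_arrayD(2)[OF inv, of 0 b c] by simp
  qed
  define \<kappa> where "\<kappa> = real k + 1"
  have inv': "invariant_array t l g k (\<lambda>a b c. \<beta> b c a)"
    using invariant_array_rotate[OF invariant_array_rotate[OF inv]] .
  have \<kappa>: "8 \<le> \<kappa>" using k unfolding \<kappa>_def by simp
  have c1: "g \<noteq> 0 \<and> derivative_relation \<kappa> g (t - 1)"
    using weight_cases[OF inv nz k \<kappa>_def refl] vanish \<open>l = 0\<close> by blast
  have c2: "derivative_relation \<kappa> t (g - 1)"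
    using weight_cases[OF inv' _ k \<kappa>_def refl, where x = z and y = x and z = y] nz vanish \<open>l = 0\<close> by blast
  show False using zero_weight_contradiction[OF \<kappa>] c1 c2 by blast
qed

text \<open>The exceptional values of the bracket relation with nonzero weights have t = 1 and l = g = (1 - kappa)/2.
They are ruled out from the first slot, whose two partners then have the distinct weights g and t.\<close>

lemma slot_weight_is_dual_weight:
  fixes \<kappa> l g t :: real
  assumes \<kappa>: "8 \<le> \<kappa>" and nz: "l \<noteq> 0" "t \<noteq> 0"
    and z: "product_relation \<kappa> l g (t - 1) \<or> g = l \<and> bracket_relation \<kappa> l (t - 1)"
    and x: "product_relation \<kappa> g t (l - 1) \<or> t = g \<and> bracket_relation \<kappa> g (l - 1)"
  shows "l + g + 2 * t + \<kappa> = 2"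
proof (rule ccontr)
  assume ne: "\<not> ?thesis"
  then have t: "t = 1" and g: "g = l" and l: "2 * l = 1 - \<kappa>"
    using z nz unfolding product_relation_def bracket_relation_def by auto
  have "t \<noteq> g" using t g l \<kappa> by auto
  then have "g + t + 2 * (l - 1) + \<kappa> = 0" using x unfolding product_relation_def by auto
  then show False using t g l \<kappa> by auto
qed

lemma nonzero_weights_contradiction:
  fixes \<kappa> l g t :: real
  assumes \<kappa>: "8 \<le> \<kappa>" and nz: "l \<noteq> 0" "g \<noteq> 0" "t \<noteq> 0"
    and z: "product_relation \<kappa> l g (t - 1) \<or> g = l \<and> bracket_relation \<kappa> l (t - 1)"
    and x: "product_relation \<kappa> g t (l - 1) \<or> t = g \<and> bracket_relation \<kappa> g (l - 1)"
    and y: "product_relation \<kappa> t l (g - 1) \<or> l = t \<and> bracket_relation \<kappa> t (g - 1)"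
  shows False
proof -
  have "l + g + 2 * t + \<kappa> = 2" "g + t + 2 * l + \<kappa> = 2" "t + l + 2 * g + \<kappa> = 2"
    using slot_weight_is_dual_weight[OF \<kappa> nz(1,3) z x] slot_weight_is_dual_weight[OF \<kappa> nz(2,1) x y]
      slot_weight_is_dual_weight[OF \<kappa> nz(3,2) y z] by simp_all
  then have t: "t = (2 - \<kappa>) / 4" by auto
  define s where "s = t - 1"
  have s: "4 * s = - (\<kappa> + 2)" unfolding s_def t by simp
  from z consider "(\<kappa> + 1) * (\<kappa> + 2) + 18 * s * (\<kappa> + 1) + 72 * s^2 = 0"
    | "\<kappa>^2 + 18 * \<kappa> * s + 56 * s^2 + \<kappa> - 18 * s - 2 = 0"
    | "s = 0" | "s = - 1"
    unfolding product_relation_def bracket_relation_def s_def by blast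
  then show False
  proof cases
    case 1
    then have "(\<kappa> + 2) * (2 * \<kappa> + 11) = 0" using s by algebra
    then show False using \<kappa> by auto
  next
    case 2
    then have "\<kappa> + 2 = 0" using s by algebra
    then show False using \<kappa> by auto
  qed (use s \<kappa> in auto)
qed

lemma invariant_array_zero:
  assumes inv: "invariant_array l g t k \<beta>" and k: "7 \<le> k"
  shows "\<beta> a b c = 0"
proof (rule ccontr)
  assume nz: "\<beta> a b c \<noteq> 0"
  define \<kappa> where "\<kappa> = real k + 1"
  have \<kappa>: "8 \<le> \<kappa>" using k unfolding \<kappa>_def by simp
  have inv': "invariant_array g t l k (\<lambda>a b c. \<beta> c a b)"
    using invariant_array_rotate[OF inv] .
  have inv'': "invariant_array t l g k (\<lambda>a b c. \<beta> b c a)"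
    using invariant_array_rotate[OF inv'] .
  have l: "l \<noteq> 0" using first_weight_nonzero[OF inv nz k] .
  have g: "g \<noteq> 0" using first_weight_nonzero[OF inv' _ k, where x = b and y = c and z = a] nz by simp
  have t: "t \<noteq> 0" using first_weight_nonzero[OF inv'' _ k, where x = c and y = a and z = b] nz by simp
  have z: "product_relation \<kappa> l g (t - 1) \<or> g = l \<and> bracket_relation \<kappa> l (t - 1)"
    using weight_cases[OF inv nz k \<kappa>_def refl] l g by blast
  have x: "product_relation \<kappa> g t (l - 1) \<or> t = g \<and> bracket_relation \<kappa> g (l - 1)"
    using weight_cases[OF inv' _ k \<kappa>_def refl, where x = b and y = c and z = a] nz g t by blast
  have y: "product_relation \<kappa> t l (g - 1) \<or> l = t \<and> bracket_relation \<kappa> t (g - 1)"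
    using weight_cases[OF inv'' _ k \<kappa>_def refl, where x = c and y = a and z = b] nz t l by blast
  show False using nonzero_weights_contradiction[OF \<kappa> l g t z x y] .
qed

section \<open>From operators to arrays\<close>

lemma linear_functional_zero:
  fixes L :: "real poly \<Rightarrow> real"
  assumes add: "\<And>p q. L (p + q) = L p + L q" and smult: "\<And>c p. L (smult c p) = c * L p"
    and mono: "\<And>n. L (monom 1 n) = 0"
  shows "L p = 0"
proof -
  have "L 0 = 0" using smult[of 0 0] by simp
  moreover have "L (monom c n) = 0" for c n
    using smult[of c "monom 1 n"] mono[of n] by (simp add: smult_monom)
  ultimately have "L (\<Sum>i\<le>n. monom (coeff p i) i) = 0" for n
    by (induction n) (simp_all add: add)
  from this[of "degree p"] show ?thesis by (simp add: poly_as_sum_of_monoms)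
qed

lemma poly_eq_0_if_derivatives_vanish:
  fixes p :: "real poly"
  assumes "\<And>n. poly ((pderiv ^^ n) p) 0 = 0"
  shows "p = 0"
proof -
  have "coeff p n = 0" for n
    using assms[of n] by (simp add: poly_0_coeff_0 coeff_higher_pderiv pochhammer_eq_0_iff)
  then show ?thesis by (simp add: poly_eq_iff)
qed

locale multilinear =
  fixes A :: "real poly \<Rightarrow> real poly \<Rightarrow> real poly \<Rightarrow> real poly"
  assumes add1: "A (p + q) \<psi> \<chi> = A p \<psi> \<chi> + A q \<psi> \<chi>"
    and add2: "A \<phi> (p + q) \<chi> = A \<phi> p \<chi> + A \<phi> q \<chi>"
    and add3: "A \<phi> \<psi> (p + q) = A \<phi> \<psi> p + A \<phi> \<psi> q"
    and smult1: "A (smult c p) \<psi> \<chi> = smult c (A p \<psi> \<chi>)"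
    and smult2: "A \<phi> (smult c p) \<chi> = smult c (A \<phi> p \<chi>)"
    and smult3: "A \<phi> \<psi> (smult c p) = smult c (A \<phi> \<psi> p)"
begin

text \<open>Evaluating at 0 loses nothing: by translation invariance every derivative at 0 of a value of the
operator is a sum of values of the operator at 0.\<close>

definition moment :: "nat \<Rightarrow> nat \<Rightarrow> nat \<Rightarrow> real" where
  "moment a b c = poly (A (monom 1 a) (monom 1 b) (monom 1 c)) 0"

lemma value_zero_if_moments_zero:
  assumes "\<And>a b c. moment a b c = 0"
  shows "poly (A \<phi> \<psi> \<chi>) 0 = 0"
proof -
  note zero = assms[unfolded moment_def]
  have 3: "poly (A (monom 1 a) (monom 1 b) \<chi>) 0 = 0" for a b \<chi>
    by (rule linear_functional_zero[where L = "\<lambda>\<chi>. poly (A (monom 1 a) (monom 1 b) \<chi>) 0"])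
      (simp_all add: add3 smult3 zero)
  have 2: "poly (A (monom 1 a) \<psi> \<chi>) 0 = 0" for a \<psi> \<chi>
    by (rule linear_functional_zero[where L = "\<lambda>\<psi>. poly (A (monom 1 a) \<psi> \<chi>) 0"])
      (simp_all add: add2 smult2 3)
  show ?thesis
    by (rule linear_functional_zero[where L = "\<lambda>\<phi>. poly (A \<phi> \<psi> \<chi>) 0"])
      (simp_all add: add1 smult1 2)
qed

lemma zero_if_moments_zero:
  assumes inv: "vect_invariant lam gam tau mu A" and zero: "\<And>a b c. moment a b c = 0"
  shows "A \<phi> \<psi> \<chi> = 0"
proof (rule poly_eq_0_if_derivatives_vanish)
  have translate: "pderiv (A \<phi> \<psi> \<chi>) = A (pderiv \<phi>) \<psi> \<chi> + A \<phi> (pderiv \<psi>) \<chi> + A \<phi> \<psi> (pderiv \<chi>)" for \<phi> \<psi> \<chi>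
    using inv[unfolded vect_invariant_def, rule_format, of 1 \<phi> \<psi> \<chi>] by (simp add: lie_density_def)
  show "poly ((pderiv ^^ n) (A \<phi> \<psi> \<chi>)) 0 = 0" for n
  proof (induction n arbitrary: \<phi> \<psi> \<chi>)
    case 0
    then show ?case using value_zero_if_moments_zero[OF zero] by simp
  next
    case (Suc n)
    then show ?case
      by (simp add: translate higher_pderiv_add funpow_Suc_right del: funpow.simps)
  qed
qed

lemma lie_density_monom:
  "lie_density w (monom 1 (q + 1)) (monom 1 n) = smult (real n + real (q + 1) * w) (monom 1 (n + q))"
  by (cases n) (simp_all add: lie_density_def pderiv_monom mult_monom smult_monom add_monom algebra_simps)

lemma poly_lie_density_0:
  "poly (lie_density mu (monom 1 (q + 1)) p) 0 = (if q = 0 then mu * poly p 0 else 0)"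
  by (simp add: lie_density_def pderiv_monom poly_monom)

lemma moment_relation:
  assumes "vect_invariant lam gam tau mu A"
  shows "(real a + real (q + 1) * lam) * moment (a + q) b c + (real b + real (q + 1) * gam) * moment a (b + q) c +
    (real c + real (q + 1) * tau) * moment a b (c + q) = (if q = 0 then mu * moment a b c else 0)"
proof -
  have "poly (lie_density mu (monom 1 (q + 1)) (A (monom 1 a) (monom 1 b) (monom 1 c))) 0 =
      poly (A (lie_density lam (monom 1 (q + 1)) (monom 1 a)) (monom 1 b) (monom 1 c) +
        A (monom 1 a) (lie_density gam (monom 1 (q + 1)) (monom 1 b)) (monom 1 c) +
        A (monom 1 a) (monom 1 b) (lie_density tau (monom 1 (q + 1)) (monom 1 c))) 0"
    using assms unfolding vect_invariant_def by simp
  then show ?thesis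
    unfolding poly_lie_density_0 lie_density_monom smult1 smult2 smult3 moment_def by simp
qed

lemma invariant_array_moment:
  assumes "vect_invariant lam gam tau (lam + gam + tau + real k) A"
  shows "invariant_array lam gam tau k moment"
proof -
  have "(real k - real (a + b + c)) * moment a b c = 0" for a b c
    using moment_relation[OF assms, of a 0 b c] by (simp add: algebra_simps)
  then have "moment a b c = 0" if "a + b + c \<noteq> k" for a b c
    using that by (metis mult_eq_0_iff of_nat_eq_iff right_minus_eq)
  then show ?thesis
    using moment_relation[OF assms] unfolding invariant_array_def by simp
qed

end

lemma multilinear_if_differential:
  assumes "ternary_diff_op k A"
  shows "multilinear A"
proof -
  obtain \<alpha> where A: "\<And>\<phi> \<psi> \<chi>. A \<phi> \<psi> \<chi> = (\<Sum>(i, j, l) | i + j + l \<le> k.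
      \<alpha> i j l * (pderiv ^^ i) \<phi> * (pderiv ^^ j) \<psi> * (pderiv ^^ l) \<chi>)"
    using assms unfolding ternary_diff_op_def by blast
  have smult_sum: "smult c (sum F S) = (\<Sum>x\<in>S. smult c (F x))" for c :: real and F S
    using sum_distrib_left[of "[:c:]" F S] by simp
  show ?thesis
    by unfold_locales
      (simp_all add: A higher_pderiv_add higher_pderiv_smult smult_sum case_prod_unfold
        distrib_left distrib_right sum.distrib)
qed

theorem mainTheorem6:
  fixes k :: nat and lam gam tau :: real
  assumes "k > 6"
  shows "\<not> (\<exists>A. ternary_diff_op k A \<and>
                vect_invariant lam gam tau (lam + gam + tau + real k) A \<and>
                A \<noteq> (\<lambda>_ _ _. 0))"
proof
  assume "\<exists>A. ternary_diff_op k A \<and> vect_invariant lam gam tau (lam + gam + tau + real k) A \<and>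
    A \<noteq> (\<lambda>_ _ _. 0)"
  then obtain A where A: "ternary_diff_op k A"
    and inv: "vect_invariant lam gam tau (lam + gam + tau + real k) A" and "A \<noteq> (\<lambda>_ _ _. 0)"
    by blast
  interpret multilinear A using multilinear_if_differential[OF A] .
  have "moment a b c = 0" for a b c
    using invariant_array_zero[OF invariant_array_moment[OF inv]] assms by simp
  then have "A \<phi> \<psi> \<chi> = 0" for \<phi> \<psi> \<chi> using zero_if_moments_zero[OF inv] by blast
  then have "A = (\<lambda>_ _ _. 0)" by (intro ext)
  then show False using \<open>A \<noteq> (\<lambda>_ _ _. 0)\<close> by simp
qed

end
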